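(* The measure $\mu_0(d\phi\times d\eta)=\frac{d\phi}{2\pi}\,\delta_0(d\eta)$ on $[0,2\pi]\times\mathcal{H}_s$ is an ergodic measure for the equation $$\langle\mathfrak{L}_0f,\mu_0\rangle=0\qquad\text{for all test functions } f\in C^2([0,2\pi]\times\mathcal{H}_s),$$ where $\mathfrak{L}_0f=b_c^{\mathfrak{c}}\frac{\partial f}{\partial\phi}+\frac{\partial f}{\partial\eta}(\mathcal{A}_s\eta)$.
   Context: $\mathcal{H}=L^2(E)$, $E\subseteq\mathbb{R}^n$ bounded, is a separable Hilbert space with inner product $\langle\cdot,\cdot\rangle$ and norm $\|\cdot\|$; complex eigenvectors live in the complexification, to which $\langle\cdot,\cdot\rangle$ is extended bilinearly. $\mathbb{Z}_0=\mathbb{Z}\setminus\{0\}$. For $\gamma\in\mathbb{R}$, $\mathcal{A}(\gamma)$ is an unbounded linear operator on $\mathcal{H}$ with purely discrete point spectrum such that for all $\gamma$: (1) the point spectrum is $\{\rho_k(\gamma)\}_{k\in\mathbb{Z}_0}$, $\rho_k(\gamma)=a_k(\gamma)+ib_k(\gamma)\in\mathbb{C}$, $\rho_{-k}(\gamma)=\overline{\rho_k(\gamma)}$; (2) each $\rho_k$ is analytic in $\gamma$ and $a_1(\gamma)>a_2(\gamma)\ge\dots\ge a_k(\gamma)\ge\dots$; (3) the corresponding eigenvectors $\{e_k\}_{k\in\mathbb{Z}_0}$ form a complete orthonormal basis of $\mathcal{H}$ with $\mathcal{A}(\gamma)e_k=\rho_k(\gamma)e_k$, $\langle e_{-k},e_k\rangle=1$,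 and $\langle e_i,e_j\rangle=0$ if $i+j\neq0$. $\gamma_c\in\mathbb{R}$ satisfies $a_{\pm1}(\gamma_c)=0$, $a_{\pm1}'(\gamma_c)\ne0$, $b_{\pm1}(\gamma_c)\neq0$, the rest of the spectrum being in the open left half-plane; $b_c^{\mathfrak{c}}:=b_1(\gamma_c)$. $\mathfrak{h}:=e_1$, $\bar{\mathfrak{h}}:=e_{-1}$, with adjoint eigenvectors $\mathfrak{h}^*,\bar{\mathfrak{h}}^*$ satisfying $\langle\mathfrak{h}^*,\mathfrak{h}\rangle=\langle\bar{\mathfrak{h}}^*,\bar{\mathfrak{h}}\rangle=1$, $\langle\mathfrak{h}^*,\bar{\mathfrak{h}}\rangle=\langle\bar{\mathfrak{h}}^*,\mathfrak{h}\rangle=0$. $P_cu=\langle\mathfrak{h}^*,u\rangle\mathfrak{h}+\langle\bar{\mathfrak{h}}^*,u\rangle\bar{\mathfrak{h}}$, $P_s=I-P_c$, $\mathcal{H}_s=P_s\mathcal{H}$, $\mathcal{A}_s=P_s\mathcal{A}(\gamma)$ (taken the same for all $\gamma$). For each $\gamma$, $\mathcal{A}(\gamma)$ generates an analytic compact $C_0$ semigroup $e^{t\mathcal{A}(\gamma)}$ on $\mathcal{H}$ commuting with $P_c$, and there are $M_s,c_s>0$ with $\|e^{t\mathcal{A}(\gamma)}u\|\le M_se^{-c_st}\|u\|$ for $u\in\mathcal{H}_s$, $t\ge0$, and $M>0,c\ge0$ with $\|e^{t\mathcal{A}(\gamma)}u\|\le Me^{ct}\|u\|$ for all $u\in\mathcal{H}$,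 $t\ge0$. $[0,2\pi]$ is the set of phase angles (endpoints identified), so functions of $\phi$ are understood as functions on the circle. $\langle f,\mu\rangle=\int f\,d\mu$. The operator $\mathfrak{L}_0$ is the generator of the deterministic flow $\dot\phi=b_c^{\mathfrak{c}}$, $\dot\eta=\mathcal{A}_s\eta$ on $[0,2\pi]\times\mathcal{H}_s$; "ergodic" refers to this flow. *)

theory Defs
  imports "HOL-Probability.Probability" "HOL-Library.Real_Mod"
begin

section \<open>The Hilbert space and its complexification\<close>

definition square_integrable_on :: "(real ^ 'n \<Rightarrow> real) \<Rightarrow> (real ^ 'n) set \<Rightarrow> bool" where
  "square_integrable_on f E \<longleftrightarrow>
     f \<in> borel_measurable (lebesgue_on E) \<and> integrable (lebesgue_on E) (\<lambda>x. (f x)\<^sup>2)"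

text \<open>There is no type of the form L2(E) with a variable set E. That the Hilbert space \<open>'h\<close> is
  L2(E) is expressed by a class map \<open>cls\<close>, sending each square integrable function to its class.
  Preservation of inner products makes \<open>cls\<close> linear on square integrable functions and makes two of
  them have the same class exactly when they agree almost everywhere on E.\<close>

definition L2_class_map ::
  "(real ^ 'n) set \<Rightarrow> ((real ^ 'n \<Rightarrow> real) \<Rightarrow> 'h::real_inner) \<Rightarrow> bool" where
  "L2_class_map E cls \<longleftrightarrow>
     (\<forall>f g. square_integrable_on f E \<longrightarrow> square_integrable_on g E \<longrightarrow>
        cls f \<bullet> cls g = (\<integral>x. f x * g x \<partial>lebesgue_on E)) \<and>
     cls ` {f. square_integrable_on f E} = UNIV"

text \<open>The pair \<open>(u, v)\<close> stands for \<open>u + i v\<close>; the norm of the product type is the norm of the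
  complexification.\<close>

type_synonym 'h cplx = "'h \<times> 'h"

definition cscale :: "complex \<Rightarrow> 'h cplx \<Rightarrow> 'h::real_vector cplx" where
  "cscale z w = (Re z *\<^sub>R fst w - Im z *\<^sub>R snd w, Re z *\<^sub>R snd w + Im z *\<^sub>R fst w)"

definition cconj :: "'h cplx \<Rightarrow> 'h::real_vector cplx" where
  "cconj w = (fst w, - snd w)"

text \<open>Bilinear, not sesquilinear, extension of the inner product.\<close>

definition cpair :: "'h cplx \<Rightarrow> 'h::real_inner cplx \<Rightarrow> complex" where
  "cpair v w = Complex (fst v \<bullet> fst w - snd v \<bullet> snd w) (fst v \<bullet> snd w + snd v \<bullet> fst w)"

definition cplx_op :: "('h \<Rightarrow> 'h) \<Rightarrow> 'h cplx \<Rightarrow> 'h cplx" where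
  "cplx_op A w = (A (fst w), A (snd w))"


section \<open>Unbounded operators and their spectrum\<close>

text \<open>An unbounded operator is a domain \<open>D\<close> with a function \<open>A\<close>, whose values off \<open>D\<close> are
  irrelevant.\<close>

definition linear_operator :: "'h set \<Rightarrow> ('h \<Rightarrow> 'h::real_vector) \<Rightarrow> bool" where
  "linear_operator D A \<longleftrightarrow> subspace D \<and>
     (\<forall>u\<in>D. \<forall>v\<in>D. \<forall>r s. A (r *\<^sub>R u + s *\<^sub>R v) = r *\<^sub>R A u + s *\<^sub>R A v)"

definition eigenspace :: "'h set \<Rightarrow> ('h \<Rightarrow> 'h) \<Rightarrow> complex \<Rightarrow> 'h::real_vector cplx set" where
  "eigenspace D A z = {w \<in> D \<times> D. cplx_op A w = cscale z w}"

definition point_spectrum :: "'h set \<Rightarrow> ('h \<Rightarrow> 'h::real_vector) \<Rightarrow> complex set" where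
  "point_spectrum D A = {z. \<exists>w\<in>eigenspace D A z. w \<noteq> 0}"

definition resolvent_set :: "'h set \<Rightarrow> ('h \<Rightarrow> 'h::real_normed_vector) \<Rightarrow> complex set" where
  "resolvent_set D A = {z. \<exists>R. bounded_linear R \<and>
     (\<forall>w. R w \<in> D \<times> D \<and> cscale z (R w) - cplx_op A (R w) = w) \<and>
     (\<forall>w\<in>D \<times> D. R (cscale z w - cplx_op A w) = w)}"

definition spectrum :: "'h set \<Rightarrow> ('h \<Rightarrow> 'h::real_normed_vector) \<Rightarrow> complex set" where
  "spectrum D A = - resolvent_set D A"

definition purely_discrete_spectrum :: "'h set \<Rightarrow> ('h \<Rightarrow> 'h::real_normed_vector) \<Rightarrow> bool" where
  "purely_discrete_spectrum D A \<longleftrightarrow>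
     spectrum D A = point_spectrum D A \<and>
     (\<forall>z. \<not> z islimpt spectrum D A) \<and>
     (\<forall>z\<in>point_spectrum D A. \<exists>F. finite F \<and> eigenspace D A z \<subseteq> span F)"

text \<open>\<open>w\<close> is in the domain of the adjoint with respect to the bilinear pairing, and the adjoint
  maps it to \<open>z w\<close>; hence the eigenvalue of the adjoint eigenvector is \<open>z\<close> itself, not its
  conjugate.\<close>

definition adjoint_eigenvector ::
  "'h set \<Rightarrow> ('h \<Rightarrow> 'h) \<Rightarrow> complex \<Rightarrow> 'h::real_inner cplx \<Rightarrow> bool" where
  "adjoint_eigenvector D A z w \<longleftrightarrow> w \<noteq> 0 \<and>
     (\<forall>v\<in>D \<times> D. cpair w (cplx_op A v) = cpair (cscale z w) v)"

definition real_analytic :: "(real \<Rightarrow> complex) \<Rightarrow> bool" where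
  "real_analytic f \<longleftrightarrow> (\<forall>x0. \<exists>r>0. \<exists>c. \<forall>x. \<bar>x - x0\<bar> < r \<longrightarrow>
     (\<lambda>n. c n * complex_of_real (x - x0) ^ n) sums f x)"


section \<open>Semigroups\<close>

definition C0_semigroup :: "(real \<Rightarrow> 'h \<Rightarrow> 'h::real_normed_vector) \<Rightarrow> bool" where
  "C0_semigroup S \<longleftrightarrow>
     (\<forall>t\<ge>0. bounded_linear (S t)) \<and>
     (\<forall>u. S 0 u = u) \<and>
     (\<forall>s\<ge>0. \<forall>t\<ge>0. \<forall>u. S (s + t) u = S s (S t u)) \<and>
     (\<forall>u. ((\<lambda>t. S t u) \<longlongrightarrow> u) (at_right 0))"

text \<open>The equivalence says both that \<open>D\<close> is the set of all points where the difference quotient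
  converges and that \<open>A\<close> is its limit there.\<close>

definition generates ::
  "'h set \<Rightarrow> ('h \<Rightarrow> 'h) \<Rightarrow> (real \<Rightarrow> 'h \<Rightarrow> 'h::real_normed_vector) \<Rightarrow> bool" where
  "generates D A S \<longleftrightarrow> C0_semigroup S \<and>
     (\<forall>u v. u \<in> D \<and> A u = v \<longleftrightarrow> ((\<lambda>t. (1 / t) *\<^sub>R (S t u - u)) \<longlongrightarrow> v) (at_right 0))"

definition compact_semigroup :: "(real \<Rightarrow> 'h \<Rightarrow> 'h::real_normed_vector) \<Rightarrow> bool" where
  "compact_semigroup S \<longleftrightarrow> (\<forall>t>0. compact (closure (S t ` cball 0 1)))"

definition sector :: "real \<Rightarrow> complex set" where
  "sector \<theta> = {z. z \<noteq> 0 \<and> \<bar>Arg z\<bar> < \<theta>}"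

text \<open>Extension to a strongly holomorphic semigroup on an open sector, strongly continuous at 0 in
  every smaller sector. Strong holomorphy is equivalent to holomorphy in the operator norm.\<close>

definition analytic_semigroup :: "(real \<Rightarrow> 'h \<Rightarrow> 'h::real_normed_vector) \<Rightarrow> bool" where
  "analytic_semigroup S \<longleftrightarrow> (\<exists>\<theta>\<in>{0<..pi / 2}. \<exists>T :: complex \<Rightarrow> 'h cplx \<Rightarrow> 'h cplx.
     (\<forall>z\<in>sector \<theta>. bounded_linear (T z) \<and> (\<forall>c w. T z (cscale c w) = cscale c (T z w))) \<and>
     (\<forall>t>0. T (complex_of_real t) = cplx_op (S t)) \<and>
     (\<forall>y\<in>sector \<theta>. \<forall>z\<in>sector \<theta>. \<forall>w. T (y + z) w = T y (T z w)) \<and>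
     (\<forall>z\<in>sector \<theta>. \<forall>w. \<exists>l. ((\<lambda>y. cscale (1 / (y - z)) (T y w - T z w)) \<longlongrightarrow> l) (at z)) \<and>
     (\<forall>\<theta>'\<in>{0<..<\<theta>}. \<forall>w. ((\<lambda>z. T z w) \<longlongrightarrow> w) (at 0 within sector \<theta>')))"


section \<open>The critical projection\<close>

definition Pc_cplx :: "'h cplx \<Rightarrow> 'h cplx \<Rightarrow> 'h cplx \<Rightarrow> 'h::real_inner cplx" where
  "Pc_cplx h hs w = cscale (cpair hs w) h + cscale (cpair (cconj hs) w) (cconj h)"

text \<open>The two summands are conjugate to each other on real vectors, so the imaginary part that is
  discarded here is zero.\<close>

definition Pc :: "'h cplx \<Rightarrow> 'h cplx \<Rightarrow> 'h \<Rightarrow> 'h::real_inner" where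
  "Pc h hs u = fst (Pc_cplx h hs (u, 0))"

lemma Pc_cplx_real: "Pc_cplx h hs (u, 0) = (Pc h hs u, 0)"
  by (simp add: Pc_def Pc_cplx_def prod_eq_iff cscale_def cpair_def cconj_def)

definition Ps :: "'h cplx \<Rightarrow> 'h cplx \<Rightarrow> 'h \<Rightarrow> 'h::real_inner" where
  "Ps h hs u = u - Pc h hs u"

definition Hs :: "'h cplx \<Rightarrow> 'h cplx \<Rightarrow> 'h::real_inner set" where
  "Hs h hs = range (Ps h hs)"


section \<open>Standing assumptions\<close>

text \<open>\<open>D \<gamma>\<close> and \<open>A \<gamma>\<close> are the domain and the operator at parameter \<open>\<gamma>\<close>, \<open>S \<gamma>\<close> its semigroup,
  \<open>\<rho>\<close> and \<open>e\<close> eigenvalues and eigenvectors (index 0 is unused), \<open>hs\<close> the adjoint eigenvector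
  paired with \<open>h = e 1\<close>. An overline is complex conjugation: \<open>e (-1)\<close> is the conjugate of \<open>e 1\<close>
  and the second adjoint eigenvector is \<open>cconj hs\<close>.\<close>

locale hopf_setting =
  fixes E :: "(real ^ 'n) set"
    and cls :: "(real ^ 'n \<Rightarrow> real) \<Rightarrow>
                  'h::{real_inner, complete_space, second_countable_topology}"
    and D :: "real \<Rightarrow> 'h set"
    and A :: "real \<Rightarrow> 'h \<Rightarrow> 'h"
    and S :: "real \<Rightarrow> real \<Rightarrow> 'h \<Rightarrow> 'h"
    and \<rho> :: "int \<Rightarrow> real \<Rightarrow> complex"
    and e :: "int \<Rightarrow> 'h cplx"
    and hs :: "'h cplx"
    and \<gamma>c :: real
  assumes E_measurable: "E \<in> sets lebesgue"
    and E_bounded: "bounded E"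
    and H_is_L2: "L2_class_map E cls"
    and A_linear: "linear_operator (D \<gamma>) (A \<gamma>)"
    and A_discrete: "purely_discrete_spectrum (D \<gamma>) (A \<gamma>)"
    and point_spectrum_eq: "point_spectrum (D \<gamma>) (A \<gamma>) = {\<rho> k \<gamma> | k. k \<noteq> 0}"
    and \<rho>_conj: "k \<noteq> 0 \<Longrightarrow> \<rho> (- k) \<gamma> = cnj (\<rho> k \<gamma>)"
    and \<rho>_analytic: "k \<noteq> 0 \<Longrightarrow> real_analytic (\<rho> k)"
    and \<rho>_gap: "Re (\<rho> 1 \<gamma>) > Re (\<rho> 2 \<gamma>)"
    and \<rho>_decreasing: "k \<ge> 2 \<Longrightarrow> Re (\<rho> k \<gamma>) \<ge> Re (\<rho> (k + 1) \<gamma>)"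
    and e_eigen: "k \<noteq> 0 \<Longrightarrow> e k \<in> eigenspace (D \<gamma>) (A \<gamma>) (\<rho> k \<gamma>)"
    and e_normalized: "k \<noteq> 0 \<Longrightarrow> cpair (e (- k)) (e k) = 1"
    and e_orthogonal: "j \<noteq> 0 \<Longrightarrow> k \<noteq> 0 \<Longrightarrow> j + k \<noteq> 0 \<Longrightarrow> cpair (e j) (e k) = 0"
    and e_basis: "((\<lambda>k. cscale (cpair (e (- k)) w) (e k)) has_sum w) {k. k \<noteq> 0}"
    and a_crit: "k \<in> {1, - 1} \<Longrightarrow> Re (\<rho> k \<gamma>c) = 0"
    and a_crit_deriv: "k \<in> {1, - 1} \<Longrightarrow> deriv (\<lambda>\<gamma>. Re (\<rho> k \<gamma>)) \<gamma>c \<noteq> 0"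
    and b_crit: "k \<in> {1, - 1} \<Longrightarrow> Im (\<rho> k \<gamma>c) \<noteq> 0"
    and stable_rest: "z \<in> spectrum (D \<gamma>c) (A \<gamma>c) - {\<rho> 1 \<gamma>c, \<rho> (- 1) \<gamma>c} \<Longrightarrow> Re z < 0"
    and h_conj: "e (- 1) = cconj (e 1)"
    and hs_adjoint: "adjoint_eigenvector (D \<gamma>) (A \<gamma>) (\<rho> 1 \<gamma>) hs"
    and hs_conj_adjoint: "adjoint_eigenvector (D \<gamma>) (A \<gamma>) (\<rho> (- 1) \<gamma>) (cconj hs)"
    and hs_normalized: "cpair hs (e 1) = 1" "cpair (cconj hs) (e (- 1)) = 1"
    and hs_orthogonal: "cpair hs (e (- 1)) = 0" "cpair (cconj hs) (e 1) = 0"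
    and As_indep: "D \<gamma> \<inter> Hs (e 1) hs = D \<gamma>' \<inter> Hs (e 1) hs"
      "u \<in> D \<gamma> \<inter> Hs (e 1) hs \<Longrightarrow> Ps (e 1) hs (A \<gamma> u) = Ps (e 1) hs (A \<gamma>' u)"
    and A_generates: "generates (D \<gamma>) (A \<gamma>) (S \<gamma>)"
    and S_analytic: "analytic_semigroup (S \<gamma>)"
    and S_compact: "compact_semigroup (S \<gamma>)"
    and S_Pc: "t \<ge> 0 \<Longrightarrow> S \<gamma> t (Pc (e 1) hs u) = Pc (e 1) hs (S \<gamma> t u)"
    and S_stable: "\<exists>Ms>0. \<exists>cs>0. \<forall>u\<in>Hs (e 1) hs. \<forall>t\<ge>0.
        norm (S \<gamma> t u) \<le> Ms * exp (- cs * t) * norm u"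
    and S_bound: "\<exists>M>0. \<exists>c\<ge>0. \<forall>u. \<forall>t\<ge>0. norm (S \<gamma> t u) \<le> M * exp (c * t) * norm u"


section \<open>The flow, its generator and the test functions\<close>

text \<open>The circle is represented by \<open>{0..<2 * pi}\<close> as a measure space (the endpoint \<open>2 * pi\<close> is the
  point 0), and functions on the circle by \<open>2 * pi\<close>-periodic functions on the line.\<close>

definition \<mu>0 :: "'h::real_inner set \<Rightarrow> (real \<times> 'h) measure" where
  "\<mu>0 H = density (restrict_space lborel {0..<2 * pi}) (\<lambda>_. ennreal (1 / (2 * pi)))
           \<Otimes>\<^sub>M return (restrict_space borel H) 0"

definition phase_flow :: "real \<Rightarrow> (real \<Rightarrow> 'h \<Rightarrow> 'h) \<Rightarrow> real \<Rightarrow> real \<times> 'h \<Rightarrow> real \<times> 'h" where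
  "phase_flow b T t = (\<lambda>(\<phi>, \<eta>). ((\<phi> + b * t) rmod (2 * pi), T t \<eta>))"

text \<open>Ergodicity for a flow in forward time, with sets invariant up to null sets; this includes
  all strictly invariant sets.\<close>

definition ergodic_measure :: "'a measure \<Rightarrow> (real \<Rightarrow> 'a \<Rightarrow> 'a) \<Rightarrow> bool" where
  "ergodic_measure M \<Phi> \<longleftrightarrow> prob_space M \<and>
     (\<forall>t\<ge>0. \<Phi> t \<in> M \<rightarrow>\<^sub>M M \<and> distr M M (\<Phi> t) = M) \<and>
     (\<forall>B\<in>sets M. (\<forall>t\<ge>0. AE x in M. \<Phi> t x \<in> B \<longleftrightarrow> x \<in> B) \<longrightarrow>
        measure M B = 0 \<or> measure M B = 1)"

text \<open>For a closed subspace \<open>V\<close>, derivatives along \<open>V\<close> extend to the whole space by composition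
  with the orthogonal projection, so asking for derivatives in the ambient dual is no restriction.\<close>

definition C2_on :: "'v::real_normed_vector set \<Rightarrow> ('v \<Rightarrow> real) \<Rightarrow> bool" where
  "C2_on V f \<longleftrightarrow> (\<exists>(f' :: 'v \<Rightarrow> 'v \<Rightarrow>\<^sub>L real) (f'' :: 'v \<Rightarrow> 'v \<Rightarrow>\<^sub>L 'v \<Rightarrow>\<^sub>L real).
     (\<forall>x\<in>V. (f has_derivative blinfun_apply (f' x)) (at x within V)) \<and>
     (\<forall>x\<in>V. (f' has_derivative blinfun_apply (f'' x)) (at x within V)) \<and>
     continuous_on V f'')"

definition test_functions :: "'h::real_inner set \<Rightarrow> (real \<times> 'h \<Rightarrow> real) set" where
  "test_functions H = {f. C2_on (UNIV \<times> H) f \<and> (\<forall>\<phi>. \<forall>\<eta>\<in>H. f (\<phi> + 2 * pi, \<eta>) = f (\<phi>, \<eta>))}"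

text \<open>The Frechet derivative within \<open>H\<close> is determined only on vectors of \<open>H\<close>, and \<open>As \<eta>\<close> is one.
  Off the domain \<open>Ds\<close> of \<open>As\<close> the expression has no meaning and is set to 0; \<open>\<mu>0\<close> does not
  charge that part of the space, since 0 is in \<open>Ds\<close>.\<close>

definition L0 :: "real \<Rightarrow> 'h set \<Rightarrow> 'h set \<Rightarrow> ('h \<Rightarrow> 'h) \<Rightarrow>
    (real \<times> 'h \<Rightarrow> real) \<Rightarrow> real \<times> 'h::real_inner \<Rightarrow> real" where
  "L0 b H Ds As f = (\<lambda>(\<phi>, \<eta>). if \<eta> \<in> Ds
     then b * deriv (\<lambda>\<psi>. f (\<psi>, \<eta>)) \<phi> + frechet_derivative (\<lambda>\<zeta>. f (\<phi>, \<zeta>)) (at \<eta> within H) (As \<eta>)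
     else 0)"

context hopf_setting
begin

lemma bounded_linear_Ps: "bounded_linear (Ps (e 1) hs)"
  unfolding Ps_def Pc_def Pc_cplx_def cscale_def cpair_def cconj_def
  by (simp, intro bounded_linear_intros)

lemma Pc_idem: "Pc (e 1) hs (Pc (e 1) hs u) = Pc (e 1) hs u"
proof -
  have lin: "cpair v (cscale a x + cscale b y) = a * cpair v x + b * cpair v y"
    for v x y :: "'h cplx" and a b
    by (simp add: cpair_def cscale_def complex_eq_iff algebra_simps inner_simps)
  let ?P = "Pc_cplx (e 1) hs"
  have "cpair hs (?P w) = cpair hs w" "cpair (cconj hs) (?P w) = cpair (cconj hs) w" for w
    using hs_normalized hs_orthogonal by (simp_all add: Pc_cplx_def lin h_conj)
  hence "?P (?P w) = ?P w" for w
    by (simp add: Pc_cplx_def)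
  from this[of "(u, 0)"] show ?thesis
    by (simp add: Pc_cplx_real)
qed

lemma Ps_idem: "Ps (e 1) hs (Ps (e 1) hs u) = Ps (e 1) hs u"
proof -
  interpret bounded_linear "Ps (e 1) hs" by (rule bounded_linear_Ps)
  have "Ps (e 1) hs (Pc (e 1) hs u) = 0"
    by (simp add: Ps_def Pc_idem)
  thus ?thesis
    by (subst (2) Ps_def) (simp add: diff)
qed

lemma Hs_iff: "\<eta> \<in> Hs (e 1) hs \<longleftrightarrow> Ps (e 1) hs \<eta> = \<eta>"
  unfolding Hs_def using Ps_idem by (metis rangeE rangeI)

lemma closed_Hs: "closed (Hs (e 1) hs)"
proof -
  have "Hs (e 1) hs = {\<eta>. Ps (e 1) hs \<eta> = \<eta>}"
    using Hs_iff by blast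
  moreover have "closed {\<eta>. Ps (e 1) hs \<eta> = \<eta>}"
    by (intro closed_Collect_eq continuous_on_id
          linear_continuous_on bounded_linear_Ps)
  ultimately show ?thesis by simp
qed

lemma S_Hs:
  assumes "t \<ge> 0" "\<eta> \<in> Hs (e 1) hs"
  shows "S \<gamma> t \<eta> \<in> Hs (e 1) hs"
proof -
  have "bounded_linear (S \<gamma> t)"
    using A_generates assms(1) by (auto simp: generates_def C0_semigroup_def)
  then interpret bounded_linear "S \<gamma> t" .
  have "Ps (e 1) hs (S \<gamma> t \<eta>) = S \<gamma> t (Ps (e 1) hs \<eta>)"
    by (simp add: Ps_def diff S_Pc[OF assms(1)])
  thus ?thesis
    using assms(2) by (simp add: Hs_iff)
qed

text \<open>Hence the restriction of \<open>S \<gamma>\<close> to \<open>Hs\<close> is the semigroup generated by \<open>As = Ps A\<close> with domain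
  \<open>D \<gamma> \<inter> Hs\<close>.\<close>

lemma As_generates:
  assumes "\<eta> \<in> Hs (e 1) hs"
  shows "\<eta> \<in> D \<gamma> \<inter> Hs (e 1) hs \<and> Ps (e 1) hs (A \<gamma> \<eta>) = v \<longleftrightarrow>
    ((\<lambda>t. (1 / t) *\<^sub>R (S \<gamma> t \<eta> - \<eta>)) \<longlongrightarrow> v) (at_right 0)"
proof -
  interpret Ps: bounded_linear "Ps (e 1) hs" by (rule bounded_linear_Ps)
  have gen: "\<eta> \<in> D \<gamma> \<and> A \<gamma> \<eta> = y \<longleftrightarrow>
      ((\<lambda>t. (1 / t) *\<^sub>R (S \<gamma> t \<eta> - \<eta>)) \<longlongrightarrow> y) (at_right 0)" for y
    using A_generates by (auto simp: generates_def)
  have "eventually (\<lambda>t::real. t \<ge> 0) (at_right 0)"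
    by (auto simp: eventually_at_filter)
  hence ev: "eventually (\<lambda>t. (1 / t) *\<^sub>R (S \<gamma> t \<eta> - \<eta>) \<in> Hs (e 1) hs) (at_right 0)"
    by eventually_elim
       (use S_Hs[OF _ assms] assms in \<open>simp add: Hs_iff Ps.scaleR Ps.diff\<close>)
  have "y \<in> Hs (e 1) hs"
    if "((\<lambda>t. (1 / t) *\<^sub>R (S \<gamma> t \<eta> - \<eta>)) \<longlongrightarrow> y) (at_right 0)" for y
    by (rule Lim_in_closed_set[OF closed_Hs ev _ that]) simp
  hence "Ps (e 1) hs y = y"
    if "((\<lambda>t. (1 / t) *\<^sub>R (S \<gamma> t \<eta> - \<eta>)) \<longlongrightarrow> y) (at_right 0)" for y
    using that by (simp add: Hs_iff)
  thus ?thesis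
    using gen assms by (metis IntD1 IntI)
qed

end

end

theory Submission
  imports Defs
begin

text \<open>The measure is the image of normalised Lebesgue measure on the circle under \<open>\<phi> \<mapsto> (\<phi>, 0)\<close>,
  and on the circle \<open>\<eta> = 0\<close> the flow is a rotation at speed \<open>b \<noteq> 0\<close>. So invariance is rotation
  invariance of Lebesgue measure. For ergodicity, a set that is invariant up to null sets under all
  rotations satisfies \<open>x + s \<in> X \<longleftrightarrow> x \<in> X\<close> for some \<open>x\<close> and almost all \<open>s\<close>, by Fubini, so it is null
  or conull. The generator equation is the fundamental theorem of calculus on the circle, as the
  \<open>\<eta>\<close>-derivative is applied to 0. Off that circle only measurability matters:
  \<open>L0 f (\<phi>, \<eta>) = f' (\<phi>, \<eta>) (b, As \<eta>)\<close>, where \<open>f'\<close> is continuous and the generator is a limit of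
  continuous difference quotients on a Borel domain.\<close>

section \<open>Normalised Lebesgue measure on the circle\<close>

text \<open>The right-hand side copies the first factor of \<open>\<mu>0\<close> literally, so that
  \<open>circle_def[symmetric]\<close> folds it after \<open>\<mu>0_def\<close> has been
  unfolded.\<close>

definition circle :: "real measure" where
  "circle = density (restrict_space lborel {0..<2 * pi}) (\<lambda>_. ennreal (1 / (2 * pi)))"

lemma space_circle [simp]: "space circle = {0..<2 * pi}"
  by (simp add: circle_def space_restrict_space)

lemma sets_circle [measurable_cong]: "sets circle = sets (restrict_space borel {0..<2 * pi})"
  by (simp add: circle_def sets_restrict_space)

lemma borel_measurable_circle: "f \<in> borel_measurable borel \<Longrightarrow> f \<in> borel_measurable circle"
  using measurable_cong_sets[OF sets_circle refl] measurable_restrict_space1 by blast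

lemma nn_integral_circle:
  assumes "f \<in> borel_measurable borel"
  shows "(\<integral>\<^sup>+x. f x \<partial>circle) =
    ennreal (1 / (2 * pi)) * (\<integral>\<^sup>+x. f x * indicator {0..<2 * pi} x \<partial>lborel)"
proof -
  have "f \<in> borel_measurable (restrict_space lborel {0..<2 * pi})"
    using assms by (intro measurable_restrict_space1) simp
  then show ?thesis
    unfolding circle_def
    by (simp add: nn_integral_density nn_integral_cmult nn_integral_restrict_space)
qed

interpretation circle: prob_space circle
proof
  have "emeasure circle (space circle) = (\<integral>\<^sup>+x. 1 \<partial>circle)"
    by simp
  also have "\<dots> = ennreal (1 / (2 * pi)) * ennreal (2 * pi)"
    by (subst nn_integral_circle) auto
  also have "\<dots> = 1"
    by (simp flip: ennreal_mult)
  finally show "emeasure circle (space circle) = 1" .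
qed

text \<open>Translation moves the window from \<open>{0..<p}\<close> to \<open>{s..<p + s}\<close>.
  The part that sticks out, \<open>{p..<p + s}\<close>, is moved back by one period to
  \<open>{0..<s}\<close> and fills the gap.\<close>

lemma nn_integral_periodic_shift:
  fixes g :: "real \<Rightarrow> ennreal"
  assumes [measurable]: "g \<in> borel_measurable borel"
    and periodic: "\<And>x. g (x + p) = g x" and s: "0 \<le> s" "s < p"
  shows "(\<integral>\<^sup>+x. g (x + s) * indicator {0..<p} x \<partial>lborel) =
    (\<integral>\<^sup>+x. g x * indicator {0..<p} x \<partial>lborel)"
proof -
  have shift: "(\<integral>\<^sup>+x. h x \<partial>lborel) = (\<integral>\<^sup>+x. h (c + x) \<partial>lborel)"
    if "h \<in> borel_measurable borel" for h :: "real \<Rightarrow> ennreal" and c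
    using nn_integral_real_affine[OF that, of 1 c] by simp
  have "(\<integral>\<^sup>+x. g (x + s) * indicator {0..<p} x \<partial>lborel) =
      (\<integral>\<^sup>+x. g x * indicator {s..<p + s} x \<partial>lborel)"
    by (subst (2) shift[of _ s]) (auto intro!: nn_integral_cong simp: indicator_def add.commute)
  also have "\<dots> = (\<integral>\<^sup>+x. g x * indicator {s..<p} x + g x * indicator {p..<p + s} x \<partial>lborel)"
    using s by (intro nn_integral_cong) (auto simp: indicator_def)
  also have "\<dots> = (\<integral>\<^sup>+x. g x * indicator {s..<p} x \<partial>lborel) +
      (\<integral>\<^sup>+x. g x * indicator {p..<p + s} x \<partial>lborel)"
    by (rule nn_integral_add) measurable
  also have "(\<integral>\<^sup>+x. g x * indicator {p..<p + s} x \<partial>lborel) =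
      (\<integral>\<^sup>+x. g x * indicator {0..<s} x \<partial>lborel)"
    by (subst shift[of _ p])
       (auto intro!: nn_integral_cong simp: indicator_def periodic add.commute[of p])
  also have "(\<integral>\<^sup>+x. g x * indicator {s..<p} x \<partial>lborel) + \<dots> =
      (\<integral>\<^sup>+x. g x * indicator {s..<p} x + g x * indicator {0..<s} x \<partial>lborel)"
    by (rule nn_integral_add[symmetric]) measurable
  also have "\<dots> = (\<integral>\<^sup>+x. g x * indicator {0..<p} x \<partial>lborel)"
    using s by (intro nn_integral_cong) (auto simp: indicator_def)
  finally show ?thesis .
qed

section \<open>Rotations: invariance and ergodicity of the circle measure\<close>

lemma rmod_add_left: "(x rmod m + y) rmod m = (x + y) rmod m"
  by (metis rmod_add rmod_rmod)

lemma rmod_2pi_in: "x rmod (2 * pi) \<in> {0..<2 * pi}"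
  by (simp add: rmod_nonneg rmod_less)

lemma rmod_2pi_add: "(x + 2 * pi) rmod (2 * pi) = x rmod (2 * pi)"
  using rmod_add_left[of "2 * pi" "2 * pi" x] by (simp add: add.commute)

lemma measurable_rmod [measurable]: "(\<lambda>x. x rmod m) \<in> borel_measurable borel"
  unfolding rmod_def by measurable

lemma measurable_rmod_circle:
  "f \<in> borel_measurable M \<Longrightarrow> (\<lambda>x. f x rmod (2 * pi)) \<in> M \<rightarrow>\<^sub>M circle"
  by (subst measurable_cong_sets[OF refl sets_circle], rule measurable_restrict_space2)
     (use rmod_2pi_in in auto)

lemma measurable_circle_ident: "(\<lambda>x. x) \<in> circle \<rightarrow>\<^sub>M borel"
  by (rule borel_measurable_circle) simp

lemma measurable_rotation: "(\<lambda>x. (x + s) rmod (2 * pi)) \<in> circle \<rightarrow>\<^sub>M circle"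
  by (intro measurable_rmod_circle borel_measurable_add measurable_circle_ident) simp

text \<open>The indicator of a set, extended periodically to the line by \<open>rmod\<close>, falls
  under \<open>nn_integral_periodic_shift\<close>.\<close>

lemma distr_rotation: "distr circle circle (\<lambda>x. (x + s) rmod (2 * pi)) = circle"
proof (rule measure_eqI)
  fix X assume "X \<in> sets (distr circle circle (\<lambda>x. (x + s) rmod (2 * pi)))"
  hence X: "X \<in> sets circle" by simp
  hence X_borel [measurable]: "X \<in> sets borel" and X_sub: "X \<subseteq> {0..<2 * pi}"
    by (auto simp: sets_circle sets_restrict_space_iff)
  \<comment> \<open>The periodic shift lemma allows shifts within one period only, so
    \<open>s\<close> is reduced to \<open>r\<close>; the periodic function \<open>g\<close> does not
    see the difference.\<close>
  define r where "r = s rmod (2 * pi)"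
  define g :: "real \<Rightarrow> ennreal" where "g x = indicator X (x rmod (2 * pi))" for x
  have [measurable]: "g \<in> borel_measurable borel"
    unfolding g_def by measurable
  have g_shift: "g (x + s) = g (x + r)" for x
    using rmod_add_left[of s "2 * pi" x] by (simp add: g_def r_def add.commute)
  have "emeasure (distr circle circle (\<lambda>x. (x + s) rmod (2 * pi))) X =
      (\<integral>\<^sup>+x. indicator X x \<partial>distr circle circle (\<lambda>x. (x + s) rmod (2 * pi)))"
    using X by simp
  also have "\<dots> = (\<integral>\<^sup>+x. g (x + s) \<partial>circle)"
    using X by (subst nn_integral_distr[OF measurable_rotation]) (auto simp: g_def)
  also have "\<dots> = (\<integral>\<^sup>+x. g x \<partial>circle)"
    unfolding g_shift using rmod_2pi_in[of s]
    by (subst (1 2) nn_integral_circle)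
       (auto simp: r_def g_def rmod_2pi_add intro!: nn_integral_periodic_shift[THEN arg_cong])
  also have "\<dots> = (\<integral>\<^sup>+x. indicator X x \<partial>circle)"
    by (intro nn_integral_cong) (simp add: g_def)
  also have "\<dots> = emeasure circle X"
    using X by simp
  finally show "emeasure (distr circle circle (\<lambda>x. (x + s) rmod (2 * pi))) X = emeasure circle X" .
qed simp

text \<open>The exceptional null set in \<open>inv\<close> may depend on \<open>s\<close>.
  Exchanging the two almost-everywhere quantifiers yields a single \<open>x\<close> that works for
  almost all \<open>s\<close>, and the image of \<open>circle\<close> under rotation by
  \<open>x\<close> is \<open>circle\<close> again, so membership in \<open>X\<close> is almost
  everywhere constant.\<close>

lemma rotations_ergodic:
  assumes X: "X \<in> sets circle"
    and inv: "\<And>s. s \<in> {0..<2 * pi} \<Longrightarrow> AE x in circle. (x + s) rmod (2 * pi) \<in> X \<longleftrightarrow> x \<in> X"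
  shows "measure circle X = 0 \<or> measure circle X = 1"
proof -
  interpret pair_sigma_finite circle circle ..
  note [measurable] = X
  have [measurable]: "(\<lambda>z. (snd z + fst z) rmod (2 * pi)) \<in> circle \<Otimes>\<^sub>M circle \<rightarrow>\<^sub>M circle"
    by (intro measurable_rmod_circle borel_measurable_add
          measurable_compose[OF measurable_snd measurable_circle_ident]
          measurable_compose[OF measurable_fst measurable_circle_ident])
  have "AE s in circle. AE x in circle. (x + s) rmod (2 * pi) \<in> X \<longleftrightarrow> x \<in> X"
    by (intro AE_I2 inv) simp
  hence "AE x in circle. AE s in circle. (x + s) rmod (2 * pi) \<in> X \<longleftrightarrow> x \<in> X"
    by (subst (asm) AE_commute) measurable
  then obtain x where "AE s in circle. (x + s) rmod (2 * pi) \<in> X \<longleftrightarrow> x \<in> X"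
    using circle.ae_filter_bot eventually_happens'[of "ae_filter circle"] by blast
  \<comment> \<open>The roles are exchanged here: \<open>x\<close> is now the fixed rotation angle
    and \<open>s\<close> the moving point.\<close>
  hence "AE s in circle. (s + x) rmod (2 * pi) \<in> X \<longleftrightarrow> x \<in> X"
    by (simp add: add.commute)
  hence "AE y in distr circle circle (\<lambda>s. (s + x) rmod (2 * pi)). y \<in> X \<longleftrightarrow> x \<in> X"
    by (subst AE_distr_iff[OF measurable_rotation]) measurable
  hence ae: "AE y in circle. y \<in> X \<longleftrightarrow> x \<in> X"
    by (simp only: distr_rotation)
  show ?thesis
  proof (cases "x \<in> X")
    case True
    with ae X show ?thesis by (simp add: circle.prob_eq_1)
  next
    case False
    with ae X show ?thesis by (simp add: circle.prob_eq_0)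
  qed
qed

section \<open>The fundamental theorem of calculus on the circle\<close>

lemma circle_integral_derivative:
  assumes deriv: "\<And>x. (g has_real_derivative g' x) (at x)"
    and cont: "continuous_on UNIV g'" and periodic: "g (2 * pi) = g 0"
  shows "integrable circle g'" "(\<integral>x. g' x \<partial>circle) = 0"
proof -
  have [measurable]: "g' \<in> borel_measurable borel"
    using cont by (rule borel_measurable_continuous_onI)
  have meas: "g' \<in> borel_measurable (restrict_space lborel {0..<2 * pi})"
    by (intro measurable_restrict_space1) simp
  \<comment> \<open>The fundamental theorem is stated on the closed interval, the circle is
    half-open; the endpoint \<open>2 * pi\<close> is a null set.\<close>
  have ae: "AE x in lborel. g' x * indicator {0..2 * pi} x = indicator {0..<2 * pi} x * g' x"
    by (rule AE_mp[OF AE_lborel_singleton[of "2 * pi"]]) (auto simp: indicator_def)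
  have "has_bochner_integral lborel (\<lambda>x. g' x * indicator {0..2 * pi} x) (g (2 * pi) - g 0)"
    by (rule has_bochner_integral_FTC_Icc_real)
       (use deriv cont in \<open>auto simp: continuous_on_eq_continuous_at\<close>)
  hence "has_bochner_integral lborel (\<lambda>x. indicator {0..<2 * pi} x * g' x) 0"
    using periodic by (subst (asm) has_bochner_integral_cong_AE[OF _ _ ae]) auto
  hence "has_bochner_integral (restrict_space lborel {0..<2 * pi}) g' 0"
    by (auto simp: has_bochner_integral_iff integrable_restrict_space integral_restrict_space)
  thus "integrable circle g'" "(\<integral>x. g' x \<partial>circle) = 0"
    unfolding circle_def using meas
    by (auto simp: has_bochner_integral_iff integrable_real_density integral_real_density)
qed

section \<open>The measure \<open>\<mu>0\<close> as an image of the circle, and its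
  ergodicity\<close>

lemma measurable_embed_circle:
  assumes "(0 :: 'h::real_inner) \<in> H"
  shows "(\<lambda>x. (x, 0)) \<in> circle \<rightarrow>\<^sub>M circle \<Otimes>\<^sub>M restrict_space borel H"
  by (intro measurable_Pair measurable_const) (use assms in \<open>auto simp: space_restrict_space\<close>)

lemma sets_\<mu>0: "sets (\<mu>0 H) = sets (circle \<Otimes>\<^sub>M restrict_space borel H)"
  unfolding \<mu>0_def circle_def[symmetric] by (intro sets_pair_measure_cong) simp_all

text \<open>Both measures give a rectangle \<open>X \<times> Y\<close> the mass of \<open>X\<close>
  if \<open>0 \<in> Y\<close> and 0 otherwise, and rectangles determine the product measure. This
  reduces every claim about \<open>\<mu>0\<close> to one about \<open>circle\<close>.\<close>

lemma \<mu>0_eq_distr: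
  assumes H: "(0 :: 'h::real_inner) \<in> H"
  shows "\<mu>0 H = distr circle (circle \<Otimes>\<^sub>M restrict_space borel H) (\<lambda>x. (x, 0))"
  unfolding \<mu>0_def circle_def[symmetric]
proof (rule pair_measure_eqI)
  interpret R: prob_space "return (restrict_space borel H) 0"
    using H by (intro prob_space_return) (simp add: space_restrict_space)
  show "sigma_finite_measure (return (restrict_space borel H) 0)" ..
  show "sigma_finite_measure circle" ..
  fix X Y assume X: "X \<in> sets circle" and Y: "Y \<in> sets (return (restrict_space borel H) 0)"
  have "(\<lambda>x. (x, 0)) -` (X \<times> Y) \<inter> space circle = (if 0 \<in> Y then X else {})"
    using sets.sets_into_space[OF X] by auto
  thus "emeasure circle X * emeasure (return (restrict_space borel H) 0) Y =
      emeasure (distr circle (circle \<Otimes>\<^sub>M restrict_space borel H) (\<lambda>x. (x, 0))) (X \<times> Y)"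
    using X Y by (subst emeasure_distr[OF measurable_embed_circle[OF H]]) auto
qed (auto intro: sets_pair_measure_cong)

text \<open>Since \<open>T t\<close> fixes 0, the embedding of the circle intertwines rotation by
  \<open>b * t\<close> with the flow (\<open>flow_embed\<close>). Away from the embedded circle the
  flow only has to be a measurable map of the phase space.\<close>

lemma ergodic_phase_flow:
  assumes b: "b \<noteq> 0" and H: "(0 :: 'h::real_inner) \<in> H"
    and T_meas: "\<And>t. t \<ge> 0 \<Longrightarrow> T t \<in> borel_measurable borel"
    and T_H: "\<And>t u. t \<ge> 0 \<Longrightarrow> u \<in> H \<Longrightarrow> T t u \<in> H"
    and T_0: "\<And>t. t \<ge> 0 \<Longrightarrow> T t 0 = 0"
  shows "ergodic_measure (\<mu>0 H) (phase_flow b T)"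
proof -
  let ?N = "circle \<Otimes>\<^sub>M restrict_space borel H"
  let ?R = "\<lambda>s x. (x + s) rmod (2 * pi)"
  note embed = measurable_embed_circle[OF H]
  have \<mu>0: "\<mu>0 H = distr circle ?N (\<lambda>x. (x, 0))"
    by (rule \<mu>0_eq_distr[OF H])
  have flow_embed: "phase_flow b T t (x, 0) = (?R (b * t) x, 0)" if "t \<ge> 0" for t x
    using that by (simp add: phase_flow_def T_0)
  have flow_meas: "phase_flow b T t \<in> ?N \<rightarrow>\<^sub>M ?N" if "t \<ge> 0" for t
  proof -
    have "T t \<in> restrict_space borel H \<rightarrow>\<^sub>M restrict_space borel H"
      using that T_H T_meas
      by (intro measurable_restrict_space2 measurable_restrict_space1)
         (auto simp: space_restrict_space)
    thus ?thesis
      unfolding phase_flow_def case_prod_beta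
      by (intro measurable_Pair measurable_compose[OF measurable_fst measurable_rotation]
            measurable_compose[OF measurable_snd])
  qed
  have prob: "prob_space (\<mu>0 H)"
    unfolding \<mu>0 by (rule circle.prob_space_distr[OF embed])
  have inv: "distr (\<mu>0 H) (\<mu>0 H) (phase_flow b T t) = \<mu>0 H" if t: "t \<ge> 0" for t
  proof -
    \<comment> \<open>An image measure depends on its target only through the sigma-algebra, and
      \<open>\<mu>0 H\<close> has that of \<open>?N\<close>.\<close>
    have "distr (\<mu>0 H) (\<mu>0 H) (phase_flow b T t) = distr (\<mu>0 H) ?N (phase_flow b T t)"
      by (rule distr_cong) (simp_all add: sets_\<mu>0)
    also have "\<dots> = distr circle ?N (\<lambda>x. phase_flow b T t (x, 0))"
      unfolding \<mu>0 by (simp add: distr_distr[OF flow_meas[OF t] embed] o_def)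
    also have "\<dots> = distr (distr circle circle (?R (b * t))) ?N (\<lambda>x. (x, 0))"
      by (simp add: distr_distr[OF embed measurable_rotation] o_def flow_embed[OF t])
    finally show ?thesis
      by (simp add: distr_rotation \<mu>0)
  qed
  have zero_one: "measure (\<mu>0 H) B = 0 \<or> measure (\<mu>0 H) B = 1"
    if B: "B \<in> sets (\<mu>0 H)"
      and ae: "\<forall>t\<ge>0. AE x in \<mu>0 H. phase_flow b T t x \<in> B \<longleftrightarrow> x \<in> B" for B
  proof -
    have B_N [measurable]: "B \<in> sets ?N"
      using B by (simp add: sets_\<mu>0)
    \<comment> \<open>The slice of \<open>B\<close> at \<open>\<eta> = 0\<close>; its
      \<open>circle\<close> measure is the \<open>\<mu>0\<close> measure of
      \<open>B\<close>.\<close>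
    define X where "X = (\<lambda>x. (x, 0)) -` B \<inter> space circle"
    have X: "X \<in> sets circle"
      unfolding X_def by (rule measurable_sets[OF embed B_N])
    have "AE x in circle. ?R s x \<in> X \<longleftrightarrow> x \<in> X" if s: "s \<in> {0..<2 * pi}" for s
    proof -
      \<comment> \<open>The flow runs in forward time only, so for negative speed the angle \<open>s\<close> is reached
        as \<open>s - 2 * pi\<close>.\<close>
      define t where "t = (if b > 0 then s / b else (s - 2 * pi) / b)"
      have t: "t \<ge> 0"
        using s b by (auto simp: t_def divide_nonpos_neg)
      have rot: "?R (b * t) x = ?R s x" for x
        using b rmod_2pi_add[of "x + (s - 2 * pi)"] by (simp add: t_def)
      note [measurable] = flow_meas[OF t]
      have "AE x in circle. phase_flow b T t (x, 0) \<in> B \<longleftrightarrow> (x, 0) \<in> B"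
        using ae[rule_format, OF t] unfolding \<mu>0 by (subst (asm) AE_distr_iff[OF embed]) measurable
      thus ?thesis
        unfolding flow_embed[OF t] rot
        by (rule AE_mp) (intro AE_I2, use rmod_2pi_in in \<open>auto simp: X_def\<close>)
    qed
    hence "measure circle X = 0 \<or> measure circle X = 1"
      by (rule rotations_ergodic[OF X])
    thus ?thesis
      unfolding \<mu>0 X_def by (simp add: measure_distr[OF embed])
  qed
  show ?thesis
    unfolding ergodic_measure_def
    using prob inv zero_one flow_meas measurable_cong_sets[OF sets_\<mu>0 sets_\<mu>0] by blast
qed

section \<open>Borel measurability of the generator and its domain\<close>

text \<open>The limit exists iff the net is Cauchy, and for fixed \<open>\<epsilon>\<close> and \<open>\<delta>\<close> the Cauchy estimate for all
  \<open>s, t < \<delta>\<close> defines a closed set; so uncountably many times cause no problem.\<close>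

lemma borel_convergence_set:
  fixes q :: "real \<Rightarrow> 'a::topological_space \<Rightarrow> 'b::complete_space"
  assumes cont: "\<And>t. t > 0 \<Longrightarrow> continuous_on UNIV (q t)"
  shows "{u. \<exists>l. ((\<lambda>t. q t u) \<longlongrightarrow> l) (at_right 0)} \<in> sets borel"
proof -
  define F where "F n m = (\<Inter>s\<in>{0<..<1 / real (Suc m)}. \<Inter>t\<in>{0<..<1 / real (Suc m)}.
      {u. dist (q s u) (q t u) \<le> 1 / real (Suc n)})" for n m
  have "closed (F n m)" for n m
    unfolding F_def
    by (intro closed_INT ballI closed_Collect_le continuous_intros cont) auto
  hence "(\<Inter>n. \<Union>m. F n m) \<in> sets borel"
    by (intro sets.countable_INT sets.countable_UN) auto
  moreover have "{u. \<exists>l. ((\<lambda>t. q t u) \<longlongrightarrow> l) (at_right 0)} = (\<Inter>n. \<Union>m. F n m)"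
  proof (intro equalityI subsetI; clarsimp)
    fix u l n
    assume "((\<lambda>t. q t u) \<longlongrightarrow> l) (at_right 0)"
    hence "eventually (\<lambda>t. dist (q t u) l < 1 / (2 * real (Suc n))) (at_right 0)"
      by (rule tendstoD) simp
    then obtain d where d: "d > 0" "\<And>t. 0 < t \<Longrightarrow> t < d \<Longrightarrow> dist (q t u) l < 1 / (2 * real (Suc n))"
      by (auto simp: eventually_at_right_field)
    obtain m where m: "1 / real (Suc m) < d"
      using d(1) by (metis nat_approx_posE)
    have "dist (q s u) (q t u) \<le> 1 / real (Suc n)"
      if "0 < s" "s < 1 / real (Suc m)" "0 < t" "t < 1 / real (Suc m)" for s t
    proof -
      have "dist (q s u) (q t u) \<le> dist (q s u) l + dist (q t u) l"
        by (metis dist_triangle dist_commute)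
      also have "\<dots> \<le> 1 / (2 * real (Suc n)) + 1 / (2 * real (Suc n))"
        using d(2)[of s] d(2)[of t] m that by linarith
      finally show ?thesis by (simp add: field_simps)
    qed
    thus "\<exists>m. u \<in> F n m"
      unfolding F_def by (intro exI[of _ m]) auto
  next
    fix u
    assume u: "\<forall>n. \<exists>m. u \<in> F n m"
    have near: "\<exists>d>0. \<forall>s t. 0 < s \<and> s < d \<and> 0 < t \<and> t < d \<longrightarrow> dist (q s u) (q t u) < \<epsilon>"
      if "\<epsilon> > 0" for \<epsilon>
    proof -
      obtain n where n: "1 / real (Suc n) < \<epsilon>"
        using \<open>\<epsilon> > 0\<close> by (metis nat_approx_posE)
      obtain m where m: "u \<in> F n m"
        using u by blast
      show ?thesis
      proof (intro exI[of _ "1 / real (Suc m)"] conjI allI impI)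
        fix s t assume "0 < s \<and> s < 1 / real (Suc m) \<and> 0 < t \<and> t < 1 / real (Suc m)"
        hence "dist (q s u) (q t u) \<le> 1 / real (Suc n)"
          using m by (simp add: F_def)
        thus "dist (q s u) (q t u) < \<epsilon>"
          using n by simp
      qed simp
    qed
    \<comment> \<open>The net is sampled along a sequence of times. Completeness gives a limit of
      the sequence, and \<open>near\<close> carries it over to all small times.\<close>
    define X where "X n = q (1 / real (Suc n)) u" for n
    have small: "eventually (\<lambda>n. 1 / real (Suc n) < d) sequentially" if "d > 0" for d
      using LIMSEQ_Suc[OF lim_1_over_n[where 'a = real]] that by (rule order_tendstoD(2))
    have "Cauchy X"
    proof (rule metric_CauchyI)
      fix \<epsilon> :: real assume "\<epsilon> > 0"
      then obtain d where d: "d > 0"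
          "\<And>s t. 0 < s \<Longrightarrow> s < d \<Longrightarrow> 0 < t \<Longrightarrow> t < d \<Longrightarrow> dist (q s u) (q t u) < \<epsilon>"
        using near by meson
      obtain N where "\<And>n. n \<ge> N \<Longrightarrow> 1 / real (Suc n) < d"
        using small[OF d(1)] by (auto simp: eventually_sequentially)
      thus "\<exists>M. \<forall>m\<ge>M. \<forall>n\<ge>M. dist (X m) (X n) < \<epsilon>"
        unfolding X_def by (intro exI[of _ N] allI impI d(2)) auto
    qed
    then obtain l where l: "X \<longlonglongrightarrow> l"
      using Cauchy_convergent by (auto simp: convergent_def)
    have "((\<lambda>t. q t u) \<longlongrightarrow> l) (at_right 0)"
    proof (rule tendstoI)
      fix \<epsilon> :: real assume \<epsilon>: "\<epsilon> > 0"
      then obtain d where d: "d > 0"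
          "\<And>s t. 0 < s \<Longrightarrow> s < d \<Longrightarrow> 0 < t \<Longrightarrow> t < d \<Longrightarrow> dist (q s u) (q t u) < \<epsilon> / 2"
        using near[of "\<epsilon> / 2"] by (metis half_gt_zero)
      have "eventually (\<lambda>n. 1 / real (Suc n) < d \<and> dist (X n) l < \<epsilon> / 2) sequentially"
        using small[OF d(1)] tendstoD[OF l, of "\<epsilon> / 2"] \<epsilon> by (auto intro: eventually_conj)
      then obtain n where n: "1 / real (Suc n) < d" "dist (X n) l < \<epsilon> / 2"
        by (auto dest!: eventually_happens)
      have "dist (q t u) l < \<epsilon>" if "0 < t" "t < d" for t
        using d(2)[of t "1 / real (Suc n)"] that n dist_triangle[of "q t u" l "X n"]
        by (simp add: X_def)
      thus "eventually (\<lambda>t. dist (q t u) l < \<epsilon>) (at_right 0)"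
        unfolding eventually_at_right_field using d(1) by blast
    qed
    thus "\<exists>l. ((\<lambda>t. q t u) \<longlongrightarrow> l) (at_right 0)" ..
  qed
  ultimately show ?thesis by simp
qed

text \<open>The domain is exactly the set where the continuous difference quotients converge. On it
  \<open>A\<close> is their limit along \<open>t = 1 / (n + 1)\<close>. Off \<open>D\<close> the
  values of \<open>A\<close> are arbitrary, so both \<open>A\<close> and the quotients are set to 0
  there, which makes the convergence hold at every point.\<close>

lemma generator_borel:
  fixes A :: "'h \<Rightarrow> 'h::{real_normed_vector, complete_space}"
  assumes gen: "generates D A S"
  shows "D \<in> sets borel" "(\<lambda>u. if u \<in> D then A u else 0) \<in> borel_measurable borel"
proof -
  define q where "q t u = (1 / t) *\<^sub>R (S t u - u)" for t u
  have lim: "u \<in> D \<and> A u = v \<longleftrightarrow> ((\<lambda>t. q t u) \<longlongrightarrow> v) (at_right 0)" for u v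
    using gen by (simp add: generates_def q_def)
  have cont: "continuous_on UNIV (q t)" if "t > 0" for t
  proof -
    have "bounded_linear (S t)"
      using gen that by (simp add: generates_def C0_semigroup_def)
    thus ?thesis
      unfolding q_def by (intro continuous_intros linear_continuous_on)
  qed
  have "D = {u. \<exists>l. ((\<lambda>t. q t u) \<longlongrightarrow> l) (at_right 0)}"
    using lim by blast
  thus D: "D \<in> sets borel"
    using borel_convergence_set[of q, OF cont] by simp
  show "(\<lambda>u. if u \<in> D then A u else 0) \<in> borel_measurable borel"
  proof (rule borel_measurable_LIMSEQ_metric)
    show "(\<lambda>u. if u \<in> D then q (1 / real (Suc n)) u else 0) \<in> borel_measurable borel" for n
      using D cont[of "1 / real (Suc n)"]
      by (intro measurable_If_set borel_measurable_continuous_onI) auto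
    have null: "filterlim (\<lambda>n. 1 / real (Suc n)) (at_right 0) sequentially"
      using LIMSEQ_Suc[OF lim_1_over_n[where 'a = real]] by (auto simp: filterlim_at)
    show "(\<lambda>n. if u \<in> D then q (1 / real (Suc n)) u else 0) \<longlonglongrightarrow> (if u \<in> D then A u else 0)" for u
      using filterlim_compose[OF _ null, of "\<lambda>t. q t u"] lim[of u "A u"] by simp
  qed
qed

section \<open>Derivatives along a subspace and the operator \<open>L0\<close>\<close>

text \<open>A derivative within \<open>V\<close> need not be unique as a map on the whole space. On
  a direction in \<open>V\<close> it is, because the line through \<open>x\<close> stays in
  \<open>V\<close> and gives a two-sided real derivative.\<close>

lemma directional_derivative:
  fixes g :: "'v::real_normed_vector \<Rightarrow> real"
  assumes V: "subspace V" and x: "x \<in> V" and v: "v \<in> V"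
    and g: "(g has_derivative g') (at x within V)"
  shows "((\<lambda>t. g (x + t *\<^sub>R v)) has_real_derivative g' v) (at 0)"
proof -
  interpret g': bounded_linear g'
    using g by (rule has_derivative_bounded_linear)
  have "(\<lambda>t. x + t *\<^sub>R v) ` UNIV \<subseteq> V"
    using V x v by (auto intro: subspace_add subspace_scale)
  \<comment> \<open>The base point is written as the value of the line at 0, the form in which the
    chain rule expects it.\<close>
  hence "(g has_derivative g') (at (x + 0 *\<^sub>R v) within (\<lambda>t. x + t *\<^sub>R v) ` UNIV)"
    using g by (auto intro: has_derivative_subset)
  moreover have "((\<lambda>t. x + t *\<^sub>R v) has_derivative (\<lambda>t. t *\<^sub>R v)) (at 0)"
    by (auto intro!: derivative_eq_intros)
  ultimately have "((\<lambda>t. g (x + t *\<^sub>R v)) has_derivative (\<lambda>t. g' (t *\<^sub>R v))) (at 0)"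
    by (rule has_derivative_in_compose[rotated])
  thus ?thesis
    by (simp add: has_field_derivative_def g'.scaleR mult.commute[of _ "g' v"])
qed

lemma phase_derivative:
  fixes f :: "real \<times> 'h::real_inner \<Rightarrow> real"
  assumes H: "subspace H" and \<eta>: "\<eta> \<in> H"
    and f': "(f has_derivative f') (at (\<phi>, \<eta>) within UNIV \<times> H)"
  shows "((\<lambda>\<psi>. f (\<psi>, \<eta>)) has_real_derivative f' (1, 0)) (at \<phi>)"
proof -
  have "((\<lambda>t. f ((\<phi>, \<eta>) + t *\<^sub>R (1, 0))) has_real_derivative f' (1, 0)) (at 0)"
    by (rule directional_derivative[OF _ _ _ f'])
       (use H \<eta> in \<open>auto intro: subspace_Times subspace_UNIV subspace_0\<close>)
  moreover have "(\<lambda>t. f ((\<phi>, \<eta>) + t *\<^sub>R (1, 0))) = (\<lambda>t. f (t + \<phi>, \<eta>))"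
    by (simp add: add.commute)
  ultimately show ?thesis
    using DERIV_shift[of "\<lambda>\<psi>. f (\<psi>, \<eta>)" "f' (1, 0)" 0 \<phi>] by simp
qed

text \<open>\<open>frechet_derivative\<close> within \<open>H\<close> is a choice among possibly
  several derivatives. It agrees with \<open>f' (0, _)\<close> at \<open>As \<eta>\<close>, since
  both give the derivative along the same line in \<open>H\<close>; linearity of \<open>f'\<close>
  then combines the phase and \<open>\<eta>\<close> parts.\<close>

lemma L0_eq:
  fixes f :: "real \<times> 'h::real_inner \<Rightarrow> real"
  assumes H: "subspace H" and \<eta>: "\<eta> \<in> H" "\<eta> \<in> Ds" "As \<eta> \<in> H"
    and f': "(f has_derivative f') (at (\<phi>, \<eta>) within UNIV \<times> H)"
  shows "L0 b H Ds As f (\<phi>, \<eta>) = f' (b, As \<eta>)"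
proof -
  interpret f': bounded_linear f'
    using f' by (rule has_derivative_bounded_linear)
  have "(f has_derivative f') (at (\<phi>, \<eta>) within Pair \<phi> ` H)"
    using f' by (rule has_derivative_subset) auto
  moreover have "(Pair \<phi> has_derivative Pair 0) (at \<eta> within H)"
    by (intro has_derivative_Pair has_derivative_const has_derivative_ident)
  ultimately have "((\<lambda>\<zeta>. f (\<phi>, \<zeta>)) has_derivative (\<lambda>\<zeta>. f' (0, \<zeta>))) (at \<eta> within H)"
    by (rule has_derivative_in_compose[rotated])
  hence "((\<lambda>\<zeta>. f (\<phi>, \<zeta>)) has_derivative frechet_derivative (\<lambda>\<zeta>. f (\<phi>, \<zeta>)) (at \<eta> within H))
      (at \<eta> within H)"
    by (auto simp: frechet_derivative_works[symmetric] differentiable_def)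
  hence "((\<lambda>t. f (\<phi>, \<eta> + t *\<^sub>R As \<eta>)) has_real_derivative
      frechet_derivative (\<lambda>\<zeta>. f (\<phi>, \<zeta>)) (at \<eta> within H) (As \<eta>)) (at 0)"
    by (rule directional_derivative[OF H \<eta>(1,3)])
  moreover have "((\<lambda>t. f ((\<phi>, \<eta>) + t *\<^sub>R (0, As \<eta>))) has_real_derivative f' (0, As \<eta>)) (at 0)"
    by (rule directional_derivative[OF _ _ _ f'])
       (use H \<eta> in \<open>auto intro: subspace_Times subspace_UNIV\<close>)
  ultimately have "frechet_derivative (\<lambda>\<zeta>. f (\<phi>, \<zeta>)) (at \<eta> within H) (As \<eta>) = f' (0, As \<eta>)"
    using DERIV_unique by fastforce
  moreover have "deriv (\<lambda>\<psi>. f (\<psi>, \<eta>)) \<phi> = f' (1, 0)"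
    by (rule DERIV_imp_deriv[OF phase_derivative[OF H \<eta>(1) f']])
  moreover have "f' (b, As \<eta>) = b * f' (1, 0) + f' (0, As \<eta>)"
    using f'.add[of "b *\<^sub>R (1, 0)" "(0, As \<eta>)"] f'.scaleR[of b "(1, 0)"] by simp
  ultimately show ?thesis
    using \<eta>(2) by (simp add: L0_def)
qed

lemma C2_onE:
  assumes "C2_on V f"
  obtains f' where "\<And>x. x \<in> V \<Longrightarrow> (f has_derivative blinfun_apply (f' x)) (at x within V)"
    and "continuous_on V f'"
proof -
  from assms obtain f' f'' where
      f': "\<And>x. x \<in> V \<Longrightarrow> (f has_derivative blinfun_apply (f' x)) (at x within V)"
      and f'': "\<And>x. x \<in> V \<Longrightarrow> (f' has_derivative blinfun_apply (f'' x)) (at x within V)"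
    unfolding C2_on_def by blast
  from that[OF f' has_derivative_continuous_on[OF f'']] show thesis .
qed

text \<open>By \<open>L0_eq\<close> the function is the evaluation map
  \<open>(x, w) \<mapsto> f' x w\<close>, jointly continuous over \<open>UNIV \<times> H\<close>,
  composed with the measurable vector field \<open>(b, As \<eta>)\<close>.\<close>

lemma L0_measurable:
  fixes f :: "real \<times> 'h::{real_inner, second_countable_topology} \<Rightarrow> real"
  assumes f: "C2_on (UNIV \<times> H) f" and H: "subspace H"
    and Ds: "Ds \<in> sets borel" "Ds \<subseteq> H"
    and As: "\<And>\<eta>. \<eta> \<in> Ds \<Longrightarrow> As \<eta> \<in> H"
      "(\<lambda>\<eta>. if \<eta> \<in> Ds then As \<eta> else 0) \<in> borel_measurable borel"
  shows "L0 b H Ds As f \<in> borel_measurable (circle \<Otimes>\<^sub>M restrict_space borel H)"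
proof -
  let ?N = "circle \<Otimes>\<^sub>M restrict_space borel H"
  \<comment> \<open>Extension by 0 gives a measurable field on the whole space; the case distinction
    on \<open>Ds\<close> is restored after the composition.\<close>
  define Z where "Z \<eta> = (if \<eta> \<in> Ds then As \<eta> else 0)" for \<eta>
  obtain f' where f': "\<And>x. x \<in> UNIV \<times> H \<Longrightarrow>
        (f has_derivative blinfun_apply (f' x)) (at x within UNIV \<times> H)"
      and f'_cont: "continuous_on (UNIV \<times> H) f'"
    using C2_onE[OF f] by blast
  have "continuous_on ((UNIV \<times> H) \<times> UNIV) (\<lambda>(x, w). blinfun_apply (f' x) w)"
    unfolding case_prod_beta
    by (intro blinfun.continuous_on continuous_on_compose2[OF f'_cont] continuous_intros) auto
  hence app: "(\<lambda>(x, w). blinfun_apply (f' x) w) \<in>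
      borel_measurable (restrict_space borel ((UNIV \<times> H) \<times> UNIV))"
    by (rule borel_measurable_continuous_on_restrict)
  have fst_N: "fst \<in> ?N \<rightarrow>\<^sub>M borel"
    by (rule measurable_compose[OF measurable_fst measurable_circle_ident])
  have snd_N: "snd \<in> ?N \<rightarrow>\<^sub>M borel"
    by (rule measurable_compose[OF measurable_snd]) (rule measurable_restrict_space1, simp)
  have "(\<lambda>x. Z (snd x)) \<in> ?N \<rightarrow>\<^sub>M borel"
    using As(2) unfolding Z_def[symmetric] by (rule measurable_compose[OF snd_N])
  \<comment> \<open>Second countability enters here: it makes pairs of Borel maps Borel.\<close>
  hence "(\<lambda>x. ((fst x, snd x), (b, Z (snd x)))) \<in> ?N \<rightarrow>\<^sub>M borel"
    using fst_N snd_N by (intro borel_measurable_Pair) auto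
  hence "(\<lambda>x. ((fst x, snd x), (b, Z (snd x)))) \<in>
      ?N \<rightarrow>\<^sub>M restrict_space borel ((UNIV \<times> H) \<times> UNIV)"
    by (rule measurable_restrict_space2[rotated])
       (auto simp: space_pair_measure space_restrict_space)
  from measurable_compose[OF this app]
  have "(\<lambda>x. blinfun_apply (f' x) (b, Z (snd x))) \<in> borel_measurable ?N"
    by simp
  moreover have "{x \<in> space ?N. snd x \<in> Ds} \<in> sets ?N"
    using measurable_sets[OF snd_N Ds(1)] by (simp add: vimage_def Int_def conj_commute)
  ultimately have "(\<lambda>x. if snd x \<in> Ds then blinfun_apply (f' x) (b, Z (snd x)) else 0)
      \<in> borel_measurable ?N"
    by (intro measurable_If) auto
  moreover have "L0 b H Ds As f =
      (\<lambda>x. if snd x \<in> Ds then blinfun_apply (f' x) (b, Z (snd x)) else 0)"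
  proof
    fix x :: "real \<times> 'h"
    obtain \<phi> \<eta> where [simp]: "x = (\<phi>, \<eta>)" by (cases x)
    show "L0 b H Ds As f x = (if snd x \<in> Ds then blinfun_apply (f' x) (b, Z (snd x)) else 0)"
    proof (cases "\<eta> \<in> Ds")
      case True
      hence "\<eta> \<in> H" using Ds(2) by blast
      with L0_eq[where As = As, OF H this True As(1)[OF True] f'[of "(\<phi>, \<eta>)"]] True show ?thesis
        by (simp add: Z_def)
    qed (simp add: L0_def)
  qed
  ultimately show ?thesis by simp
qed

text \<open>As \<open>As 0 = 0\<close>, on the embedded circle only the phase term survives. It is
  the derivative of the periodic function \<open>b * f (\<psi>, 0)\<close>, whose integral over a
  period vanishes. Measurability on the whole product is what allows the transfer through the image
  measure.\<close>

lemma L0_integral: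
  fixes f :: "real \<times> 'h::{real_inner, second_countable_topology} \<Rightarrow> real"
  assumes f: "f \<in> test_functions H" and H: "subspace H"
    and Ds: "Ds \<in> sets borel" "Ds \<subseteq> H" "0 \<in> Ds"
    and As: "\<And>\<eta>. \<eta> \<in> Ds \<Longrightarrow> As \<eta> \<in> H" "As 0 = 0"
      "(\<lambda>\<eta>. if \<eta> \<in> Ds then As \<eta> else 0) \<in> borel_measurable borel"
  shows "integrable (\<mu>0 H) (L0 b H Ds As f)" "(\<integral>x. L0 b H Ds As f x \<partial>\<mu>0 H) = 0"
proof -
  have H0: "0 \<in> H"
    using H by (rule subspace_0)
  have C2: "C2_on (UNIV \<times> H) f" and "f (0 + 2 * pi, 0) = f (0, 0)"
    using f H0 by (auto simp only: test_functions_def mem_Collect_eq)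
  hence periodic: "f (2 * pi, 0) = f (0, 0)" by simp
  obtain f' where f': "\<And>x. x \<in> UNIV \<times> H \<Longrightarrow>
        (f has_derivative blinfun_apply (f' x)) (at x within UNIV \<times> H)"
      and f'_cont: "continuous_on (UNIV \<times> H) f'"
    using C2_onE[OF C2] by blast
  have f'0: "(f has_derivative blinfun_apply (f' (\<phi>, 0))) (at (\<phi>, 0) within UNIV \<times> H)" for \<phi>
    using f' H0 by simp
  define g' where "g' \<phi> = b * blinfun_apply (f' (\<phi>, 0)) (1, 0)" for \<phi>
  have L0_0: "L0 b H Ds As f (\<phi>, 0) = g' \<phi>" for \<phi>
    using L0_eq[OF H H0 Ds(3) _ f'0, of As b \<phi>] H0 As(2)
      blinfun.scaleR_right[of "f' (\<phi>, 0)" b "(1, 0)"]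
    by (simp add: g'_def)
  have "((\<lambda>\<psi>. b * f (\<psi>, 0)) has_real_derivative g' \<phi>) (at \<phi>)" for \<phi>
    unfolding g'_def by (rule DERIV_cmult[OF phase_derivative[OF H H0 f'0]])
  moreover have "continuous_on UNIV g'"
    unfolding g'_def
    by (intro continuous_intros blinfun.continuous_on continuous_on_compose2[OF f'_cont])
       (use H0 in auto)
  ultimately have "integrable circle g'" "(\<integral>x. g' x \<partial>circle) = 0"
    by (rule circle_integral_derivative; simp add: periodic)+
  thus "integrable (\<mu>0 H) (L0 b H Ds As f)" "(\<integral>x. L0 b H Ds As f x \<partial>\<mu>0 H) = 0"
    using L0_measurable[OF C2 H Ds(1,2) As(1,3)]
    unfolding \<mu>0_eq_distr[OF H0]
    by (simp_all add: integrable_distr_eq integral_distr measurable_embed_circle[OF H0] L0_0)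
qed

text \<open>What remains is to supply the hypotheses of \<open>ergodic_phase_flow\<close> and
  \<open>L0_integral\<close>: nonzero speed from \<open>b_crit\<close>, invariance of
  \<open>Hs\<close> from \<open>S_Hs\<close>, and a Borel domain and generator from
  \<open>generator_borel\<close>.\<close>

theorem proposition4p1:
  fixes E :: "(real ^ 'n) set"
    and cls :: "(real ^ 'n \<Rightarrow> real) \<Rightarrow>
                  'h::{real_inner, complete_space, second_countable_topology}"
    and D :: "real \<Rightarrow> 'h set"
    and A :: "real \<Rightarrow> 'h \<Rightarrow> 'h"
    and S :: "real \<Rightarrow> real \<Rightarrow> 'h \<Rightarrow> 'h"
    and \<rho> :: "int \<Rightarrow> real \<Rightarrow> complex"
    and e :: "int \<Rightarrow> 'h cplx"
    and hs :: "'h cplx"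
    and \<gamma>c :: real
  assumes "hopf_setting E cls D A S \<rho> e hs \<gamma>c"
  shows "ergodic_measure (\<mu>0 (Hs (e 1) hs)) (phase_flow (Im (\<rho> 1 \<gamma>c)) (S \<gamma>c)) \<and>
    (\<forall>f\<in>test_functions (Hs (e 1) hs).
       let L0f = L0 (Im (\<rho> 1 \<gamma>c)) (Hs (e 1) hs) (D \<gamma>c \<inter> Hs (e 1) hs)
                   (\<lambda>\<eta>. Ps (e 1) hs (A \<gamma>c \<eta>)) f
       in integrable (\<mu>0 (Hs (e 1) hs)) L0f \<and>
          (\<integral>x. L0f x \<partial>\<mu>0 (Hs (e 1) hs)) = 0)"
proof -
  interpret hopf_setting E cls D A S \<rho> e hs \<gamma>c by fact
  interpret Ps: bounded_linear "Ps (e 1) hs" by (rule bounded_linear_Ps)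
  define H where "H = Hs (e 1) hs"
  have H: "subspace H"
    unfolding H_def Hs_def by (intro linear_subspace_image Ps.linear subspace_UNIV)
  hence H0: "0 \<in> H"
    by (rule subspace_0)
  have S: "bounded_linear (S \<gamma>c t)" if "t \<ge> 0" for t
    using A_generates that by (simp add: generates_def C0_semigroup_def)
  have D: "subspace (D \<gamma>c)"
    and lin: "\<And>u v r s. u \<in> D \<gamma>c \<Longrightarrow> v \<in> D \<gamma>c \<Longrightarrow>
      A \<gamma>c (r *\<^sub>R u + s *\<^sub>R v) = r *\<^sub>R A \<gamma>c u + s *\<^sub>R A \<gamma>c v"
    using A_linear[of \<gamma>c] by (auto simp: linear_operator_def)
  have D0: "0 \<in> D \<gamma>c"
    using D by (rule subspace_0)
  have A0: "A \<gamma>c 0 = 0"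
    using lin[OF D0 D0, of 0 0] by simp
  have Ds_borel: "D \<gamma>c \<inter> H \<in> sets borel"
    using generator_borel(1)[OF A_generates] closed_Hs by (auto simp: H_def)
  have "Ps (e 1) hs \<in> borel_measurable borel"
    by (intro borel_measurable_continuous_onI linear_continuous_on bounded_linear_Ps)
  \<comment> \<open>The operator is first cut off outside its domain, where its values are
    arbitrary, and then projected; the second cut-off to \<open>D \<gamma>c \<inter> H\<close> gives
    the form that \<open>L0_integral\<close> requires.\<close>
  hence "(\<lambda>u. Ps (e 1) hs (if u \<in> D \<gamma>c then A \<gamma>c u else 0)) \<in> borel_measurable borel"
    by (rule measurable_compose[OF generator_borel(2)[OF A_generates]])
  hence "(\<lambda>u. if u \<in> D \<gamma>c \<inter> H then Ps (e 1) hs (if u \<in> D \<gamma>c then A \<gamma>c u else 0) else 0)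
      \<in> borel_measurable borel"
    using Ds_borel by (intro measurable_If_set) auto
  also have "(\<lambda>u. if u \<in> D \<gamma>c \<inter> H then Ps (e 1) hs (if u \<in> D \<gamma>c then A \<gamma>c u else 0) else 0) =
      (\<lambda>u. if u \<in> D \<gamma>c \<inter> H then Ps (e 1) hs (A \<gamma>c u) else 0)"
    by auto
  finally have As: "(\<lambda>u. if u \<in> D \<gamma>c \<inter> H then Ps (e 1) hs (A \<gamma>c u) else 0)
      \<in> borel_measurable borel" .
  have "ergodic_measure (\<mu>0 H) (phase_flow (Im (\<rho> 1 \<gamma>c)) (S \<gamma>c))"
  proof (rule ergodic_phase_flow[OF _ H0])
    show "Im (\<rho> 1 \<gamma>c) \<noteq> 0"
      using b_crit[of 1] by simp
  qed (use S S_Hs in \<open>auto simp: H_def linear_simps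
        intro!: borel_measurable_continuous_onI linear_continuous_on\<close>)
  moreover have "integrable (\<mu>0 H) (L0 b H (D \<gamma>c \<inter> H) (\<lambda>\<eta>. Ps (e 1) hs (A \<gamma>c \<eta>)) f)"
      "(\<integral>x. L0 b H (D \<gamma>c \<inter> H) (\<lambda>\<eta>. Ps (e 1) hs (A \<gamma>c \<eta>)) f x \<partial>\<mu>0 H) = 0"
    if "f \<in> test_functions H" for f b
    by (rule L0_integral[OF that H Ds_borel _ _ _ _ As];
        use D0 H0 in \<open>simp add: A0 Ps.zero H_def Hs_def\<close>)+
  ultimately show ?thesis
    by (simp add: H_def Let_def)
qed

end
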